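(* Let $k\ge 2$ be an integer. For every integer $n\geq 0$, \[ \#B'_k(n)=\#C_k(n+1), \] where $B'_k(n)$ is the set of nonempty partitions of $n$ in which no part is a multiple of $k$ and whose largest part $m$ satisfies $m\equiv -1 \pmod{k}$, and $C_k(N)$ is the set of nonempty partitions of $N$ whose largest part $m$ satisfies $m\equiv 0\pmod{k}$ and in which every part not exceeding $m/k$ appears at most $k-1$ times.
   Context: A partition of $n$ is a finite non-increasing sequence of positive integers summing to $n$. In the definition of $C_k(N)$, parts exceeding $m/k$ (other than the largest part) may be arbitrary positive integers and may appear any number of times. *)

theory Defs
  imports Complex_Main "HOL-Number_Theory.Cong"
begin

definition partitions :: "nat \<Rightarrow> nat list set" where
  "partitions n = {xs. sorted_wrt (\<ge>) xs \<and> (\<forall>p \<in> set xs. 0 < p) \<and> sum_list xs = n}"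

lemma finite_partitions: "finite (partitions n)"
proof -
  have len: "length xs \<le> sum_list xs" if "\<forall>p \<in> set xs. 0 < p" for xs :: "nat list"
    using that by (induction xs) auto
  have "partitions n \<subseteq> {xs. set xs \<subseteq> {..n} \<and> length xs \<le> n}"
    using len member_le_sum_list by (fastforce simp: partitions_def)
  then show ?thesis
    using finite_lists_length_le[of "{..n}" n] finite_subset by blast
qed

text \<open>Only meaningful for nonempty partitions.\<close>

definition largest_part :: "nat list \<Rightarrow> nat" where
  "largest_part xs = Max (set xs)"

definition B' :: "nat \<Rightarrow> nat \<Rightarrow> nat list set" where
  "B' k n = {xs \<in> partitions n. xs \<noteq> [] \<and> (\<forall>p \<in> set xs. \<not> k dvd p) \<and>
     [int (largest_part xs) = - 1] (mod int k)}"

definition C :: "nat \<Rightarrow> nat \<Rightarrow> nat list set" where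
  "C k N = {xs \<in> partitions N. xs \<noteq> [] \<and> [largest_part xs = 0] (mod k) \<and>
     (\<forall>p \<in> set xs. real p \<le> real (largest_part xs) / real k \<longrightarrow> count_list xs p \<le> k - 1)}"

end

(*
  Fix the largest part: k * j - 1 on the left, k * j on the right. Deleting it leaves partitions of
  n + 1 - k * j with parts in {1..k * j} that either avoid all multiples of k, or repeat each
  part i <= j at most k - 1 times. One passes from the first condition to the second by treating
  s = 1, ..., j in turn: Glaisher's merging of k copies of s into one copy of k * s trades the
  condition "k * s is not a part" for the condition "s appears fewer than k times".
*)
theory Submission
  imports Defs "HOL-Library.Multiset"
begin

section \<open>Glaisher's merging, one part size at a time\<close>

text \<open>The state after the sizes 1, ..., \<open>t\<close> have been treated. At
  \<open>t = 0\<close> the count bound is void and all positive multiples of \<open>k\<close> are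
  excluded. At \<open>t = j\<close>, for \<open>k \<ge> 2\<close>, the exclusion adds nothing, since
  \<open>k * i\<close> with \<open>i > j\<close> already exceeds the bound
  \<open>k * j\<close>.\<close>

definition glaisher_stage :: "nat \<Rightarrow> nat \<Rightarrow> nat \<Rightarrow> nat \<Rightarrow> nat multiset set" where
  "glaisher_stage k j N t = {M. sum_mset M = N \<and> set_mset M \<subseteq> {1..k * j} \<and>
     (\<forall>i\<in>{1..t}. count M i < k) \<and> (\<forall>i>t. k * i \<notin># M)}"

definition merge_parts :: "nat \<Rightarrow> nat \<Rightarrow> nat multiset \<Rightarrow> nat multiset" where
  "merge_parts k s M = filter_mset (\<lambda>p. p \<noteq> s) M
     + (replicate_mset (count M s mod k) s + replicate_mset (count M s div k) (k * s))"

definition split_parts :: "nat \<Rightarrow> nat \<Rightarrow> nat multiset \<Rightarrow> nat multiset" where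
  "split_parts k s M = filter_mset (\<lambda>p. p \<noteq> k * s) M + replicate_mset (k * count M (k * s)) s"

lemma sum_mset_remove_part:
  fixes M :: "nat multiset"
  shows "sum_mset (filter_mset (\<lambda>p. p \<noteq> s) M) + count M s * s = sum_mset M"
proof -
  have "M = filter_mset (\<lambda>p. p \<noteq> s) M + replicate_mset (count M s) s"
    by (rule multiset_eqI) auto
  then have "sum_mset M = sum_mset (filter_mset (\<lambda>p. p \<noteq> s) M + replicate_mset (count M s) s)"
    by simp
  then show ?thesis by simp
qed

lemma count_merge_parts:
  assumes "k \<ge> 2" "s > 0"
  shows "count (merge_parts k s M) p =
    (if p = s then count M s mod k else if p = k * s then count M p + count M s div k else count M p)"
proof -
  have "k * s \<noteq> s" using assms by simp
  then show ?thesis by (simp add: merge_parts_def)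
qed

lemma count_split_parts:
  assumes "k \<ge> 2" "s > 0"
  shows "count (split_parts k s M) p =
    (if p = s then count M s + k * count M (k * s) else if p = k * s then 0 else count M p)"
proof -
  have "k * s \<noteq> s" using assms by simp
  then show ?thesis by (simp add: split_parts_def)
qed

lemma sum_mset_merge_parts: "sum_mset (merge_parts k s M) = sum_mset M"
proof -
  have "count M s mod k * s + count M s div k * (k * s) = count M s * s"
    by (metis add_mult_distrib mod_div_mult_eq mult.assoc)
  then show ?thesis
    using sum_mset_remove_part[of s M] by (simp add: merge_parts_def)
qed

lemma sum_mset_split_parts: "sum_mset (split_parts k s M) = sum_mset M"
  using sum_mset_remove_part[of "k * s" M] by (simp add: split_parts_def mult_ac)

text \<open>Put \<open>s = Suc t\<close>. Merging loses no information because \<open>k * s\<close>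
  is absent beforehand: afterwards the count of \<open>k * s\<close> is the quotient, and the count
  of \<open>s\<close> the remainder, of the old count of \<open>s\<close> divided by
  \<open>k\<close>. Splitting recombines the two. No other count changes, so the conditions on the
  remaining sizes carry over.\<close>

lemma bij_betw_merge_parts:
  assumes k: "k \<ge> 2" and t: "t < j"
  shows "bij_betw (merge_parts k (Suc t)) (glaisher_stage k j N t) (glaisher_stage k j N (Suc t))"
proof -
  define s where "s = Suc t"
  have s: "0 < s" "t < s" "s \<le> j" using t by (auto simp: s_def)
  have t_less: "t < i \<longleftrightarrow> s \<le> i" for i by (auto simp: s_def)
  note cm = count_merge_parts[OF k s(1)]
  note cs = count_split_parts[OF k s(1)]
  \<comment> \<open>Two collisions are ruled out here: copies of \<open>s\<close> created by
    splitting are not among the multiples \<open>k * i\<close>, \<open>i > t\<close>, excluded at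
    stage \<open>t\<close>; and \<open>k * s\<close> created by merging is not among the sizes up to
    \<open>s\<close> whose counts are bounded.\<close>
  have s_less: "s < k * i" if "s \<le> i" for i
    using mult_le_mono[OF k that] s(1) by linarith
  have s_ne: "s \<noteq> k * s" using s_less[of s] by linarith
  \<comment> \<open>The merged part respects the size bound because only sizes
    \<open>s \<le> j\<close> are ever treated.\<close>
  have ks_le: "k * s \<le> k * j" using s by (intro mult_le_mono2) simp
  have ks_inj: "k * i = k * s \<longleftrightarrow> i = s" for i using k by simp
  have "bij_betw (merge_parts k s) (glaisher_stage k j N t) (glaisher_stage k j N s)"
  proof (rule bij_betw_byWitness[where f' = "split_parts k s"])
    show "\<forall>M\<in>glaisher_stage k j N t. split_parts k s (merge_parts k s M) = M"
    proof
      fix M assume "M \<in> glaisher_stage k j N t"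
      \<comment> \<open>This is the exclusion at \<open>i = s\<close>; without it, splitting would
        also break up copies of \<open>k * s\<close> that were there before the merge.\<close>
      then have "count M (k * s) = 0"
        using s by (auto simp: glaisher_stage_def not_in_iff)
      then show "split_parts k s (merge_parts k s M) = M"
        using s_ne by (intro multiset_eqI) (simp add: cm cs)
    qed
    show "\<forall>M\<in>glaisher_stage k j N s. merge_parts k s (split_parts k s M) = M"
    proof
      fix M assume "M \<in> glaisher_stage k j N s"
      \<comment> \<open>Hence adding \<open>k * c\<close> copies of \<open>s\<close> leaves the old
        count as the remainder modulo \<open>k\<close> and gives exactly \<open>c\<close> as the
        quotient.\<close>
      then have "count M s < k"
        using s by (auto simp: glaisher_stage_def)
      then show "merge_parts k s (split_parts k s M) = M"
        using s_ne by (intro multiset_eqI) (simp add: cm cs)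
    qed
    show "merge_parts k s ` glaisher_stage k j N t \<subseteq> glaisher_stage k j N s"
    proof (rule image_subsetI)
      fix M assume M: "M \<in> glaisher_stage k j N t"
      have "set_mset (merge_parts k s M) \<subseteq> insert (k * s) (set_mset M)"
      proof
        fix p assume "p \<in># merge_parts k s M"
        moreover have "p \<notin># merge_parts k s M" if "p \<noteq> k * s" "p \<notin># M"
          using that by (cases "p = s") (simp_all add: not_in_iff cm)
        ultimately show "p \<in> insert (k * s) (set_mset M)" by blast
      qed
      then have "set_mset (merge_parts k s M) \<subseteq> {1..k * j}"
        using M ks_le s_less[of s] by (auto simp: glaisher_stage_def)
      moreover have "count (merge_parts k s M) i < k" if "i \<in> {1..s}" for i
      proof (cases "i = s")
        case False
        then have "i \<in> {1..t}" "i \<noteq> k * s" using that s_less[of s] by (auto simp: s_def)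
        then show ?thesis using M False by (auto simp: cm glaisher_stage_def)
      qed (use k in \<open>simp add: cm\<close>)
      moreover have "k * i \<notin># merge_parts k s M" if i: "i > s" for i
        using M s_less[of i] ks_inj[of i] i t_less[of i] by (simp add: glaisher_stage_def not_in_iff cm)
      ultimately show "merge_parts k s M \<in> glaisher_stage k j N s"
        using M by (auto simp: glaisher_stage_def sum_mset_merge_parts)
    qed
    show "split_parts k s ` glaisher_stage k j N s \<subseteq> glaisher_stage k j N t"
    proof (rule image_subsetI)
      fix M assume M: "M \<in> glaisher_stage k j N s"
      have "set_mset (split_parts k s M) \<subseteq> insert s (set_mset M)"
        by (auto simp: split_parts_def in_replicate_mset split: if_splits)
      also have "\<dots> \<subseteq> {1..k * j}"
        using M s(1) less_imp_le[OF s_less[OF s(3)]] by (simp add: glaisher_stage_def)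
      finally have "set_mset (split_parts k s M) \<subseteq> {1..k * j}" .
      moreover have "count (split_parts k s M) i < k" if "i \<in> {1..t}" for i
      proof -
        have "i < s" using that s by simp
        then have "i \<noteq> k * s" using less_trans[OF _ s_less[OF order_refl], of i] by blast
        then show ?thesis using M that \<open>i < s\<close> by (auto simp: cs glaisher_stage_def)
      qed
      moreover have "k * i \<notin># split_parts k s M" if i: "i > t" for i
        using M i t_less[of i] s_less[of i] ks_inj[of i]
        by (cases "i = s") (simp_all add: glaisher_stage_def not_in_iff cs)
      ultimately show "split_parts k s M \<in> glaisher_stage k j N t"
        using M by (auto simp: glaisher_stage_def sum_mset_split_parts)
    qed
  qed
  then show ?thesis by (simp add: s_def)
qed

lemma card_glaisher_stage:
  assumes "k \<ge> 2" "t \<le> j"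
  shows "card (glaisher_stage k j N t) = card (glaisher_stage k j N 0)"
  using assms(2)
proof (induction t)
  case (Suc t)
  then show ?case
    using bij_betw_same_card[OF bij_betw_merge_parts[OF assms(1), of t j N]] by simp
qed simp

section \<open>Partitions with a prescribed largest part\<close>

lemma largest_part_Cons:
  assumes "sorted_wrt (\<ge>) (x # xs)"
  shows "largest_part (x # xs) = x"
  unfolding largest_part_def
proof (rule Max_eqI)
  show "y \<le> x" if "y \<in> set (x # xs)" for y
    using assms that unfolding sorted_wrt.simps by (metis order_refl set_ConsD)
qed simp_all

text \<open>Deleting the head is inverted by listing the multiset in decreasing order behind
  \<open>d\<close>; the bound \<open>{1..d}\<close> is what keeps \<open>d\<close> in front as the
  maximum. The predicate \<open>P\<close> is left free so that both families of partitions can be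
  handled by the same bijection.\<close>

lemma card_partitions_with_largest_part:
  fixes d N :: nat
  assumes "d > 0"
  shows "card {xs \<in> partitions (d + N). xs \<noteq> [] \<and> largest_part xs = d \<and> P (mset (tl xs))} =
    card {M. sum_mset M = N \<and> set_mset M \<subseteq> {1..d} \<and> P M}" (is "card ?X = card ?Y")
proof (rule bij_betw_same_card[where f = "\<lambda>xs. mset (tl xs)"],
    rule bij_betw_byWitness[where f' = "\<lambda>M. d # rev (sorted_list_of_multiset M)"])
  have head: "\<exists>ys. xs = d # ys \<and> sorted (rev ys) \<and> (\<forall>p\<in>set ys. 0 < p \<and> p \<le> d) \<and> sum_list ys = N"
    if "xs \<in> ?X" for xs
  proof (cases xs)
    case (Cons x ys)
    then have "x = d"
      using that largest_part_Cons by (auto simp: partitions_def)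
    then show ?thesis
      using that Cons by (auto simp: partitions_def sorted_wrt_rev)
  qed (use that in auto)
  show "\<forall>xs\<in>?X. d # rev (sorted_list_of_multiset (mset (tl xs))) = xs"
  proof
    fix xs assume "xs \<in> ?X"
    then obtain ys where ys: "xs = d # ys" "sorted (rev ys)"
      using head by blast
    \<comment> \<open>A multiset has only one increasing listing, so the original order of the tail
      is recovered.\<close>
    then have "sort ys = rev ys"
      by (intro properties_for_sort) auto
    then show "d # rev (sorted_list_of_multiset (mset (tl xs))) = xs"
      using ys by simp
  qed
  show "\<forall>M\<in>?Y. mset (tl (d # rev (sorted_list_of_multiset M))) = M"
    by simp
  show "(\<lambda>xs. mset (tl xs)) ` ?X \<subseteq> ?Y"
  proof (rule image_subsetI)
    fix xs assume xs: "xs \<in> ?X"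
    then obtain ys where "xs = d # ys" "\<forall>p\<in>set ys. 0 < p \<and> p \<le> d" "sum_list ys = N"
      using head by blast
    then show "mset (tl xs) \<in> ?Y"
      using xs by (auto simp: sum_mset_sum_list Suc_le_eq)
  qed
  show "(\<lambda>M. d # rev (sorted_list_of_multiset M)) ` ?Y \<subseteq> ?X"
  proof (rule image_subsetI)
    fix M assume "M \<in> ?Y"
    then have M: "set_mset M \<subseteq> {1..d}" "P M" "sum_mset M = N" by auto
    let ?xs = "d # rev (sorted_list_of_multiset M)"
    have sorted: "sorted_wrt (\<ge>) ?xs"
      using M by (auto simp: sorted_wrt_rev)
    moreover have "sum_list ?xs = d + sum_mset M"
      using sum_mset_sum_list[of "sorted_list_of_multiset M"] by (simp add: sum_list_rev)
    moreover have "\<forall>p\<in>set ?xs. 0 < p"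
      using M assms by fastforce
    ultimately have "?xs \<in> partitions (d + N)"
      using M by (simp only: partitions_def mem_Collect_eq simp_thms)
    then show "?xs \<in> ?X"
      using M largest_part_Cons[OF sorted] by simp
  qed
qed

lemma largest_part_in_set: "xs \<noteq> [] \<Longrightarrow> largest_part xs \<in> set xs"
  by (simp add: largest_part_def)

lemma largest_part_eq_hd:
  assumes "xs \<in> partitions n" "xs \<noteq> []"
  shows "largest_part xs = hd xs"
proof (cases xs)
  case (Cons x ys)
  then have "sorted_wrt (\<ge>) (x # ys)" using assms by (simp add: partitions_def)
  then show ?thesis using largest_part_Cons Cons by simp
qed (use assms in simp)

lemma largest_part_bounds:
  assumes "xs \<in> partitions n" "xs \<noteq> []"
  shows "0 < largest_part xs" "largest_part xs \<le> n"
proof -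
  have "largest_part xs \<in> set xs" using assms(2) by (rule largest_part_in_set)
  then show "0 < largest_part xs" "largest_part xs \<le> n"
    using assms(1) member_le_sum_list by (auto simp: partitions_def)
qed

section \<open>The two families sliced by largest part\<close>

lemma mem_B':
  "xs \<in> B' k n \<longleftrightarrow> xs \<in> partitions n \<and> xs \<noteq> [] \<and> (\<forall>p \<in> set xs. \<not> k dvd p) \<and> k dvd largest_part xs + 1"
proof -
  \<comment> \<open>Shifting by one replaces the residue -1, which needs integers, by a divisibility
    of naturals.\<close>
  have "[int (largest_part xs) = - 1] (mod int k) \<longleftrightarrow> int k dvd int (largest_part xs + 1)"
    by (simp add: cong_iff_dvd_diff add.commute)
  then show ?thesis
    unfolding B'_def int_dvd_int_iff by auto
qed

lemma card_B'_slice: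
  assumes k: "k \<ge> 2" and j: "j > 0" and N: "k * j + N = n + 1"
  shows "card {xs \<in> B' k n. largest_part xs + 1 = k * j} = card (glaisher_stage k j N 0)"
proof -
  \<comment> \<open>Makes the truncated subtraction in \<open>d\<close> exact and \<open>d\<close>
    positive.\<close>
  have kj: "k * j \<ge> 2" using mult_le_mono[of 2 k 1 j] k j by simp
  define d where "d = k * j - 1"
  have d: "d > 0" "d + 1 = k * j" "d + N = n" using kj N by (auto simp: d_def)
  \<comment> \<open>The deleted largest part satisfies the divisibility condition by itself:
    \<open>k\<close> divides \<open>d + 1\<close> and \<open>k \<ge> 2\<close>. So the condition on
    all parts reduces to one on the tail.\<close>
  have nd: "\<not> k dvd d"
    using k d(2) by (metis dvd_add_right_iff dvd_triv_left nat_dvd_1_iff_1 numeral_le_one_iff semiring_norm(69))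
  have "{xs \<in> B' k n. largest_part xs + 1 = k * j} =
    {xs \<in> partitions (d + N). xs \<noteq> [] \<and> largest_part xs = d \<and> (\<forall>p. p \<in># mset (tl xs) \<longrightarrow> \<not> k dvd p)}"
    (is "?L = ?R")
  proof (rule set_eqI)
    fix xs
    show "xs \<in> ?L \<longleftrightarrow> xs \<in> ?R"
    proof (cases xs)
      case (Cons x ys)
      have "largest_part xs = x" if "xs \<in> partitions n"
        using largest_part_eq_hd[OF that] Cons by simp
      then have "xs \<in> ?L \<longleftrightarrow> xs \<in> partitions n \<and> x = d \<and> (\<forall>p\<in>set xs. \<not> k dvd p)"
        unfolding mem_B' mem_Collect_eq using Cons d(2) by (metis add_right_imp_eq dvd_triv_left list.simps(3))
      also have "\<dots> \<longleftrightarrow> xs \<in> ?R"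
        using d(3) nd Cons \<open>xs \<in> partitions n \<Longrightarrow> largest_part xs = x\<close> by auto
      finally show ?thesis .
    qed (auto simp: mem_B')
  qed
  then have "card ?L = card {M. sum_mset M = N \<and> set_mset M \<subseteq> {1..d} \<and> (\<forall>p. p \<in># M \<longrightarrow> \<not> k dvd p)}"
    by (simp only: card_partitions_with_largest_part[OF d(1), where P = "\<lambda>M. \<forall>p. p \<in># M \<longrightarrow> \<not> k dvd p"])
  also have "{M. sum_mset M = N \<and> set_mset M \<subseteq> {1..d} \<and> (\<forall>p. p \<in># M \<longrightarrow> \<not> k dvd p)}
    = glaisher_stage k j N 0"
  proof -
    \<comment> \<open>The bound may be raised from \<open>k * j - 1\<close> to \<open>k * j\<close>
      because \<open>k * j\<close> is itself an excluded multiple. This gives both families the same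
      size bound.\<close>
    have "(set_mset M \<subseteq> {1..d} \<and> (\<forall>p. p \<in># M \<longrightarrow> \<not> k dvd p)) \<longleftrightarrow>
      (set_mset M \<subseteq> {1..k * j} \<and> (\<forall>i>0. k * i \<notin># M))" for M
    proof safe
      fix p assume M: "set_mset M \<subseteq> {1..k * j}" "\<forall>i>0. k * i \<notin># M" "p \<in># M"
      then have "p \<in> {1..k * j}" "p \<noteq> k * j" using j by auto
      then show "p \<in> {1..d}" by (simp flip: d(2))
    next
      fix p assume M: "set_mset M \<subseteq> {1..k * j}" "\<forall>i>0. k * i \<notin># M" "p \<in># M" "k dvd p"
      then show False by (metis atLeastAtMost_iff dvdE gr0I mult_0_right not_one_le_zero subsetD)
    next
      fix p assume "set_mset M \<subseteq> {1..d}" "p \<in># M"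
      then show "p \<in> {1..k * j}" by (auto simp flip: d(2))
    qed auto
    then show ?thesis by (auto simp: glaisher_stage_def)
  qed
  finally show ?thesis .
qed

lemma card_C_slice:
  assumes k: "k \<ge> 2" and j: "j > 0" and N: "k * j + N = n"
  shows "card {xs \<in> C k n. largest_part xs = k * j} = card (glaisher_stage k j N j)"
proof -
  have "{xs \<in> C k n. largest_part xs = k * j} =
    {xs \<in> partitions (k * j + N). xs \<noteq> [] \<and> largest_part xs = k * j \<and>
       (\<forall>i\<in>{1..j}. count (mset (tl xs)) i < k)}" (is "?L = ?R")
  proof (rule set_eqI)
    fix xs
    show "xs \<in> ?L \<longleftrightarrow> xs \<in> ?R"
    proof (cases "xs \<in> partitions n \<and> xs \<noteq> [] \<and> largest_part xs = k * j")
      case True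
      then obtain ys where xs: "xs = k * j # ys"
        using largest_part_eq_hd[of xs n] by (cases xs) auto
      have pos: "p > 0" if "p \<in> set xs" for p
        using True that by (auto simp: partitions_def)
      \<comment> \<open>Since \<open>k \<ge> 2\<close>, the largest part \<open>k * j\<close>
        exceeds \<open>j\<close>, so deleting it changes none of the restricted counts.\<close>
      have ct: "count_list xs i = count (mset ys) i" if "i \<le> j" for i
      proof -
        have "i < k * j" using that k j by (metis le_less_trans mult_less_cancel2 nat_mult_1
              one_less_numeral_iff order_less_le_trans semiring_norm(76))
        then show ?thesis by (simp add: xs flip: count_mset)
      qed
      have "real p \<le> real (largest_part xs) / real k \<longleftrightarrow> p \<le> j" for p
        using True k by simp
      then have "xs \<in> ?L \<longleftrightarrow> (\<forall>p\<in>set xs. p \<le> j \<longrightarrow> count_list xs p \<le> k - 1)"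
        using True by (auto simp: C_def cong_def)
      \<comment> \<open>Sizes that do not occur have count 0, which is below \<open>k\<close>, so
        the range can be all of \<open>{1..j}\<close>.\<close>
      also have "\<dots> \<longleftrightarrow> (\<forall>p\<in>{1..j}. count_list xs p < k)"
      proof safe
        fix p assume *: "\<forall>p\<in>set xs. p \<le> j \<longrightarrow> count_list xs p \<le> k - 1" "p \<in> {1..j}"
        show "count_list xs p < k"
        proof (cases "p \<in> set xs")
          case True
          then have "count_list xs p \<le> k - 1" using * by auto
          then show ?thesis using k by linarith
        qed (use k in \<open>simp add: count_list_0_iff\<close>)
      next
        fix p assume *: "\<forall>p\<in>{1..j}. count_list xs p < k" "p \<in> set xs" "p \<le> j"
        then have "count_list xs p < k" using pos[of p] by auto
        then show "count_list xs p \<le> k - 1" by linarith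
      qed
      also have "\<dots> \<longleftrightarrow> xs \<in> ?R"
        using True N ct by (auto simp: xs)
      finally show ?thesis .
    qed (use N in \<open>auto simp: C_def\<close>)
  qed
  then have "card ?L = card {M. sum_mset M = N \<and> set_mset M \<subseteq> {1..k * j} \<and> (\<forall>i\<in>{1..j}. count M i < k)}"
    using card_partitions_with_largest_part[of "k * j" N "\<lambda>M. \<forall>i\<in>{1..j}. count M i < k"] k j
    by (simp only: nat_0_less_mult_iff) simp
  also have "{M. sum_mset M = N \<and> set_mset M \<subseteq> {1..k * j} \<and> (\<forall>i\<in>{1..j}. count M i < k)}
    = glaisher_stage k j N j"
  proof -
    have "k * i \<notin># M" if "set_mset M \<subseteq> {1..k * j}" "i > j" for M i
      using that k by fastforce
    then show ?thesis by (auto simp: glaisher_stage_def)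
  qed
  finally show ?thesis .
qed

section \<open>Summing over the largest part\<close>

lemma card_eq_sum_fibres:
  assumes "finite A" "finite J" "inj_on g J" "f ` A \<subseteq> g ` J"
  shows "card A = (\<Sum>j\<in>J. card {x \<in> A. f x = g j})"
proof -
  have "A = (\<Union>j\<in>J. {x \<in> A. f x = g j})" using assms(4) by blast
  also have "card \<dots> = (\<Sum>j\<in>J. card {x \<in> A. f x = g j})"
    using assms by (intro card_UN_disjoint) (auto dest: inj_onD)
  finally show ?thesis .
qed

theorem theorem1p5:
  fixes k n :: nat
  assumes "k \<ge> 2"
  shows "card (B' k n) = card (C k (n + 1))"
proof -
  \<comment> \<open>One index set fits both families: \<open>k * j\<close> stands for the largest
    part plus one on the left, where that part is at most \<open>n\<close>, and for the largest part
    itself on the right, where it is at most \<open>n + 1\<close>.\<close>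
  define J where "J = {j. 0 < j \<and> k * j \<le> n + 1}"
  have inj: "inj_on ((*) k) J" using assms by (auto intro: inj_onI)
  have J: "finite J"
  proof (rule finite_subset)
    show "J \<subseteq> {..n + 1}"
    proof
      fix j assume "j \<in> J"
      then show "j \<in> {..n + 1}"
        using mult_le_mono1[of 1 k j] assms unfolding J_def atMost_iff mem_Collect_eq by linarith
    qed
  qed simp
  have mem_J: "m \<in> (*) k ` J" if "0 < m" "m \<le> n + 1" "k dvd m" for m
    using that by (auto simp: J_def elim!: dvdE)
  have fin: "finite (B' k n)" "finite (C k (n + 1))"
    using finite_partitions by (auto simp: B'_def C_def)
  have "card (B' k n) = (\<Sum>j\<in>J. card {xs \<in> B' k n. largest_part xs + 1 = k * j})"
  proof (rule card_eq_sum_fibres[OF fin(1) J inj], rule image_subsetI)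
    fix xs assume "xs \<in> B' k n"
    then have "xs \<in> partitions n" "xs \<noteq> []" "k dvd largest_part xs + 1"
      by (simp_all add: mem_B')
    then show "largest_part xs + 1 \<in> (*) k ` J"
      using largest_part_bounds by (intro mem_J) simp_all
  qed
  also have "\<dots> = (\<Sum>j\<in>J. card {xs \<in> C k (n + 1). largest_part xs = k * j})"
  proof (rule sum.cong)
    fix j assume "j \<in> J"
    \<comment> \<open>The same remainder is left on both sides, as
      \<open>n - (k * j - 1) = n + 1 - k * j\<close>; membership in \<open>J\<close> prevents
      truncation.\<close>
    then have "j > 0" and N: "k * j + (n + 1 - k * j) = n + 1"
      by (auto simp: J_def)
    show "card {xs \<in> B' k n. largest_part xs + 1 = k * j} =
      card {xs \<in> C k (n + 1). largest_part xs = k * j}"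
      unfolding card_B'_slice[OF assms \<open>j > 0\<close> N] card_C_slice[OF assms \<open>j > 0\<close> N]
      by (rule card_glaisher_stage[OF assms order_refl, symmetric])
  qed simp
  also have "\<dots> = card (C k (n + 1))"
  proof (rule card_eq_sum_fibres[OF fin(2) J inj, symmetric], rule image_subsetI)
    fix xs assume "xs \<in> C k (n + 1)"
    then have "xs \<in> partitions (n + 1)" "xs \<noteq> []" "k dvd largest_part xs"
      by (simp_all add: C_def cong_0_iff)
    then show "largest_part xs \<in> (*) k ` J"
      using largest_part_bounds by (intro mem_J) blast+
  qed
  finally show ?thesis .
qed

end
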